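(* Let $R>0$, $\kappa>0$, let $\mathcal{S}=\{(x,y)\in\mathbb{R}^2: x^2+y^2\le R^2\}$, and let $k,k'\in\{1,\dots,K\}$ be two users with far-field channel responses $h_k,h_{k'}$ on $\mathcal{S}$. Then the effective channel $$\Sigma^{\mathcal{S}}_{kk'}=\iint_{(x,y)\in\mathcal{S}}h_k^*(x,y)\,h_{k'}(x,y)\,dx\,dy$$ of the circular surface satisfies $$\Sigma^{\mathcal{S}}_{kk'}={\rm A}_{kk'}\cdot {\rm B}(R,\kappa,\chi_{kk'}),$$ where $${\rm A}_{kk'}=e^{j\left(\kappa(d_k^c-d_{k'}^c)+\varphi_k-\varphi_{k'}\right)},\qquad {\rm B}(R,\kappa,\chi_{kk'})=2\pi R\,\frac{J_1(R\kappa\chi_{kk'})}{\kappa\chi_{kk'}},$$ and $J_1$ is the Bessel function of the first kind of order $1$ (for $\chi_{kk'}=0$ the right-hand side is understood as its limit as $\chi_{kk'}\to0$).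
   Context: $j$ is the imaginary unit and $^*$ denotes complex conjugation. A circular surface of radius $R$ lies in the $xy$-plane, centered at the origin. User $k$ ($k=1,\dots,K$) is at $(x_k,y_k,z_k)\in\mathbb{R}^3$ with $z_k>0$, and $d_k^c=\sqrt{x_k^2+y_k^2+z_k^2}$. $\kappa=2\pi/\lambda$ with $\lambda>0$ the wavelength; $\varphi_k\in[-\pi,\pi]$ is a (random) phase of user $k$. In the far-field (plane-wave) model the channel response of user $k$ at the point $(x,y,0)$ is $$h_k(x,y)=\exp\!\Big(-j\Big(\kappa d_k^c+\kappa\,\frac{y_k\,y-x_k\,x}{d_k^c}+\varphi_k\Big)\Big).$$ For users $k,k'$ put $\eta_{kk'}=\frac{x_k}{d_k^c}-\frac{x_{k'}}{d_{k'}^c}$, $\xi_{kk'}=\frac{y_k}{d_k^c}-\frac{y_{k'}}{d_{k'}^c}$, and $\chi_{kk'}=\sqrt{\eta_{kk'}^2+\xi_{kk'}^2}\ge 0$. *)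

theory Defs
  imports "HOL-Analysis.Analysis"
begin

definition bessel_J :: "nat \<Rightarrow> real \<Rightarrow> real" where
  "bessel_J n x = (\<Sum>m. (-1) ^ m / (fact m * fact (m + n)) * (x / 2) ^ (2 * m + n))"

definition circular_surface :: "real \<Rightarrow> (real \<times> real) set" where
  "circular_surface R = {(x, y). x\<^sup>2 + y\<^sup>2 \<le> R\<^sup>2}"

definition centre_dist :: "real \<times> real \<times> real \<Rightarrow> real" where
  "centre_dist = (\<lambda>(x, y, z). sqrt (x\<^sup>2 + y\<^sup>2 + z\<^sup>2))"

definition far_field_channel ::
  "real \<Rightarrow> real \<times> real \<times> real \<Rightarrow> real \<Rightarrow> real \<times> real \<Rightarrow> complex" where
  "far_field_channel \<kappa> u \<phi> = (\<lambda>(x, y). case u of (x\<^sub>k, y\<^sub>k, z\<^sub>k) \<Rightarrow>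
     exp (- (\<i> * complex_of_real
       (\<kappa> * centre_dist u + \<kappa> * ((y\<^sub>k * y - x\<^sub>k * x) / centre_dist u) + \<phi>))))"

definition effective_channel ::
  "(real \<times> real) set \<Rightarrow> (real \<times> real \<Rightarrow> complex) \<Rightarrow> (real \<times> real \<Rightarrow> complex) \<Rightarrow> complex" where
  "effective_channel S h h' = (LINT p:S|lborel. cnj (h p) * h' p)"

definition eta :: "real \<times> real \<times> real \<Rightarrow> real \<times> real \<times> real \<Rightarrow> real" where
  "eta u v = fst u / centre_dist u - fst v / centre_dist v"

definition xi :: "real \<times> real \<times> real \<Rightarrow> real \<times> real \<times> real \<Rightarrow> real" where
  "xi u v = fst (snd u) / centre_dist u - fst (snd v) / centre_dist v"

definition chi :: "real \<times> real \<times> real \<Rightarrow> real \<times> real \<times> real \<Rightarrow> real" where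
  "chi u v = sqrt ((eta u v)\<^sup>2 + (xi u v)\<^sup>2)"

definition phase_factor ::
  "real \<Rightarrow> real \<times> real \<times> real \<Rightarrow> real \<Rightarrow> real \<times> real \<times> real \<Rightarrow> real \<Rightarrow> complex" where
  "phase_factor \<kappa> u \<phi> v \<psi> =
     exp (\<i> * complex_of_real (\<kappa> * (centre_dist u - centre_dist v) + \<phi> - \<psi>))"

(* The limit is one-sided because the argument is a nonnegative square root;
   that it exists is shown in surface_gain_limit below. *)
definition surface_gain :: "real \<Rightarrow> real \<Rightarrow> real \<Rightarrow> real" where
  "surface_gain R \<kappa> c =
     (let b = (\<lambda>t. 2 * pi * R * (bessel_J 1 (R * \<kappa> * t) / (\<kappa> * t)))
      in if c = 0 then Lim (at_right 0) b else b c)"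

lemma bessel_J_powser:
  defines "a \<equiv> (\<lambda>n m. (-1) ^ m / (fact m * fact (m + n)) :: real)"
  shows "summable (\<lambda>m. a n m * y ^ m)"
    and "bessel_J n x = (x / 2) ^ n * (\<Sum>m. a n m * ((x / 2)\<^sup>2) ^ m)"
proof -
  show s: "summable (\<lambda>m. a n m * y ^ m)" for y
  proof (rule summable_comparison_test')
    show "summable (\<lambda>m. inverse (fact m) * \<bar>y\<bar> ^ m)"
      by (rule summable_exp)
    fix m :: nat
    have "1 \<le> (fact (m + n) :: real)" by (rule fact_ge_1)
    hence "fact m * 1 \<le> (fact m * fact (m + n) :: real)"
      by (intro mult_left_mono) auto
    hence "inverse (fact m * fact (m + n)) \<le> (inverse (fact m) :: real)"
      by (intro le_imp_inverse_le) auto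
    thus "norm (a n m * y ^ m) \<le> inverse (fact m) * \<bar>y\<bar> ^ m"
      unfolding a_def
      by (simp add: abs_mult power_abs divide_inverse mult_right_mono)
  qed
  show "bessel_J n x = (x / 2) ^ n * (\<Sum>m. a n m * ((x / 2)\<^sup>2) ^ m)"
    unfolding bessel_J_def
    by (subst suminf_mult [OF s, symmetric], rule suminf_cong)
       (simp add: a_def power_add power_mult)
qed

lemma surface_gain_limit:
  assumes "\<kappa> \<noteq> 0"
  shows "((\<lambda>t. 2 * pi * R * (bessel_J 1 (R * \<kappa> * t) / (\<kappa> * t))) \<longlongrightarrow> pi * R\<^sup>2) (at_right 0)"
proof -
  define a where "a = (\<lambda>m. (-1) ^ m / (fact m * fact (m + 1)) :: real)"
  define g where "g = (\<lambda>y. \<Sum>m. a m * y ^ m)"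
  have J: "bessel_J 1 x = x / 2 * g ((x / 2)\<^sup>2)" for x
    using bessel_J_powser(2)[of 1 x] by (simp add: g_def a_def)
  have cont: "isCont g y" for y
    unfolding g_def
    by (rule isCont_powser_converges_everywhere) (unfold a_def, rule bessel_J_powser(1))
  have g0: "g 0 = 1"
    unfolding g_def powser_zero by (simp add: a_def)
  have "((\<lambda>t. (R * \<kappa> * t / 2)\<^sup>2) \<longlongrightarrow> (R * \<kappa> * 0 / 2)\<^sup>2) (at_right 0)"
    by (intro tendsto_intros) auto
  hence "((\<lambda>t. pi * R\<^sup>2 * g ((R * \<kappa> * t / 2)\<^sup>2)) \<longlongrightarrow> pi * R\<^sup>2 * g 0) (at_right 0)"
    by (intro tendsto_mult tendsto_const isCont_tendsto_compose [OF cont]) simp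
  moreover have "eventually (\<lambda>t. pi * R\<^sup>2 * g ((R * \<kappa> * t / 2)\<^sup>2) =
      2 * pi * R * (bessel_J 1 (R * \<kappa> * t) / (\<kappa> * t))) (at_right 0)"
    using eventually_at_right_less [of "0::real"]
    by eventually_elim (use assms in \<open>simp add: J power2_eq_square del: One_nat_def\<close>)
  ultimately show ?thesis
    using g0 by (auto elim: Lim_transform_eventually)
qed

lemma effective_channel_integrable:
  "set_integrable lborel (circular_surface R)
     (\<lambda>p. cnj (far_field_channel \<kappa> u \<phi> p) * far_field_channel \<kappa> v \<psi> p)"
proof -
  have "circular_surface R = cball 0 \<bar>R\<bar>"
    by (auto simp: circular_surface_def norm_Pair sqrt_le_D real_le_lsqrt
        dest!: sqrt_le_D)
  moreover have "continuous_on (cball 0 \<bar>R\<bar>)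
      (\<lambda>p. cnj (far_field_channel \<kappa> u \<phi> p) * far_field_channel \<kappa> v \<psi> p)"
    unfolding far_field_channel_def split_beta divide_inverse
    by (intro continuous_intros)
  ultimately show ?thesis
    unfolding set_integrable_def
    by (simp add: borel_integrable_compact)
qed

end

theory Submission
  imports Defs
begin

text \<open>
  Up to the phase factor, the effective channel is the Fourier transform of the indicator of the
  disc at the frequency \<open>\<kappa> (- \<eta>, \<xi>)\<close>. Lebesgue measure is invariant under rotations, so this
  transform depends only on the length \<open>\<kappa> \<chi>\<close> of the frequency, which may be taken along the first
  axis. Expanding the exponential there leaves the moments of the disc; the odd ones vanish, and
  the even ones satisfy a two-term recursion whose solution yields the power series of \<open>J\<^sub>1\<close>.
\<close>

section \<open>Invariance of planar Lebesgue measure under shears and rotations\<close>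

lemma emeasure_lborel_plus_vimage:
  fixes c :: real
  assumes "B \<in> sets borel"
  shows "emeasure lborel ((\<lambda>x. x + c) -` B) = emeasure lborel B"
proof -
  have "emeasure lborel B = emeasure (distr lborel borel ((+) c)) B"
    by (simp add: lborel_distr_plus)
  also have "\<dots> = emeasure lborel ((\<lambda>x. x + c) -` B)"
    using assms by (subst emeasure_distr) (auto simp: vimage_def add.commute)
  finally show ?thesis by simp
qed

text \<open>By Fubini the measure of a set is the integral of the lengths of its slices at fixed
  \<open>y\<close>. On such a slice the shear is the translation by \<open>s * y\<close>, which
  keeps the length.\<close>

lemma lborel_distr_shear_fst:
  "distr lborel borel (\<lambda>(x, y). (x + s * y, y)) = (lborel :: (real \<times> real) measure)"
proof (rule measure_eqI)
  let ?T = "\<lambda>(x, y). (x + s * y, y) :: real \<times> real"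
  fix A assume "A \<in> sets (distr lborel borel ?T)"
  hence A: "A \<in> sets borel" by simp
  have T: "?T \<in> borel_measurable borel"
    by (intro borel_measurable_continuous_onI) (auto simp: split_beta intro!: continuous_intros)
  have TA: "?T -` A \<in> sets borel" using measurable_sets[OF T A] by simp
  have "emeasure (distr lborel borel ?T) A = emeasure lborel (?T -` A)"
    using A T by (subst emeasure_distr) auto
  also have "\<dots> = (\<integral>\<^sup>+y. emeasure lborel ((\<lambda>x. (x, y)) -` (?T -` A)) \<partial>lborel)"
    using TA by (simp flip: lborel_prod borel_prod add: lborel_pair.emeasure_pair_measure_alt2)
  also have "\<dots> = (\<integral>\<^sup>+y. emeasure lborel ((\<lambda>x. (x, y)) -` A) \<partial>lborel)"
  proof (rule nn_integral_cong)
    fix y :: real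
    have "(\<lambda>x. (x, y)) \<in> borel_measurable borel"
      by (intro borel_measurable_continuous_onI continuous_intros)
    from measurable_sets[OF this A] have "(\<lambda>x. (x, y)) -` A \<in> sets borel" by simp
    from emeasure_lborel_plus_vimage[OF this, of "s * y"]
    show "emeasure lborel ((\<lambda>x. (x, y)) -` (?T -` A)) = emeasure lborel ((\<lambda>x. (x, y)) -` A)"
      by (simp add: vimage_def)
  qed
  also have "\<dots> = emeasure lborel A"
    using A by (simp flip: lborel_prod borel_prod add: lborel_pair.emeasure_pair_measure_alt2)
  finally show "emeasure (distr lborel borel ?T) A = emeasure lborel A" .
qed simp

text \<open>The same slicing argument at fixed \<open>x\<close>, where the map is the translation by
  \<open>s * x\<close>.\<close>

lemma lborel_distr_shear_snd:
  "distr lborel borel (\<lambda>(x, y). (x, y + s * x)) = (lborel :: (real \<times> real) measure)"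
proof (rule measure_eqI)
  let ?T = "\<lambda>(x, y). (x, y + s * x) :: real \<times> real"
  fix A assume "A \<in> sets (distr lborel borel ?T)"
  hence A: "A \<in> sets borel" by simp
  have T: "?T \<in> borel_measurable borel"
    by (intro borel_measurable_continuous_onI) (auto simp: split_beta intro!: continuous_intros)
  have TA: "?T -` A \<in> sets borel" using measurable_sets[OF T A] by simp
  have "emeasure (distr lborel borel ?T) A = emeasure lborel (?T -` A)"
    using A T by (subst emeasure_distr) auto
  also have "\<dots> = (\<integral>\<^sup>+x. emeasure lborel (Pair x -` (?T -` A)) \<partial>lborel)"
    using TA by (simp flip: lborel_prod borel_prod add: lborel.emeasure_pair_measure_alt)
  also have "\<dots> = (\<integral>\<^sup>+x. emeasure lborel (Pair x -` A) \<partial>lborel)"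
  proof (rule nn_integral_cong)
    fix x :: real
    have "Pair x \<in> borel_measurable borel"
      by (intro borel_measurable_continuous_onI continuous_intros)
    from measurable_sets[OF this A] have "Pair x -` A \<in> sets borel" by simp
    from emeasure_lborel_plus_vimage[OF this, of "s * x"]
    show "emeasure lborel (Pair x -` (?T -` A)) = emeasure lborel (Pair x -` A)"
      by (simp add: vimage_def)
  qed
  also have "\<dots> = emeasure lborel A"
    using A by (simp flip: lborel_prod borel_prod add: lborel.emeasure_pair_measure_alt)
  finally show "emeasure (distr lborel borel ?T) A = emeasure lborel A" .
qed simp

text \<open>A rotation with nonzero sine is a product of three shears.\<close>

lemma lborel_distr_rotation_nonzero:
  fixes a b :: real
  assumes "a\<^sup>2 + b\<^sup>2 = 1" and "b \<noteq> 0"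
  shows "distr lborel borel (\<lambda>(x, y). (a * x - b * y, b * x + a * y)) = lborel"
proof -
  \<comment> \<open>With a = cos \<theta> and b = sin \<theta> this is - tan (\<theta> / 2).
    Comparing the product of the shears \<open>?H\<close>, \<open>?V\<close>, \<open>?H\<close> with
    the rotation matrix leaves the two conditions 1 + b t = a and t + a t = - b.\<close>
  define t where "t = (a - 1) / b"
  let ?H = "\<lambda>(x, y). (x + t * y, y) :: real \<times> real"
  let ?V = "\<lambda>(x, y). (x, y + b * x) :: real \<times> real"
  have bt: "b * t = a - 1" using assms by (simp add: t_def)
  have "b * (t + a * t) = b * t * (1 + a)" by (simp add: algebra_simps)
  also have "\<dots> = (a - 1) * (1 + a)" by (simp only: bt)
  also have "\<dots> = b * (- b)" using assms(1) by (simp add: algebra_simps power2_eq_square)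
  finally have tt: "t + a * t = - b" using assms(2) by (simp only: mult_cancel_left) simp
  have eq: "(\<lambda>(x, y). (a * x - b * y, b * x + a * y)) = ?H \<circ> (?V \<circ> ?H)"
  proof (rule ext, clarify)
    fix x y
    have "x + t * y + t * (y + b * (x + t * y)) = (1 + b * t) * x + (t + (1 + b * t) * t) * y"
      and "y + b * (x + t * y) = b * x + (1 + b * t) * y"
      by (simp_all add: algebra_simps)
    thus "(a * x - b * y, b * x + a * y) = (?H \<circ> (?V \<circ> ?H)) (x, y)"
      using tt by (simp add: bt)
  qed
  have m: "?H \<in> borel_measurable borel" "?V \<in> borel_measurable borel"
    by (intro borel_measurable_continuous_onI; auto simp: split_beta intro!: continuous_intros)+
  have "distr lborel borel (?H \<circ> (?V \<circ> ?H)) = distr (distr (distr lborel borel ?H) borel ?V) borel ?H"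
    using m by (simp add: distr_distr o_assoc)
  thus ?thesis
    by (simp add: eq lborel_distr_shear_fst lborel_distr_shear_snd)
qed

text \<open>The shear factorization divides by the sine, so b = 0 is treated apart: a = 1 gives the
  identity, and the half-turn a = - 1 is the square of the quarter-turn \<open>?Q\<close>, whose
  sine is 1.\<close>

lemma lborel_distr_rotation:
  fixes a b :: real
  assumes "a\<^sup>2 + b\<^sup>2 = 1"
  shows "distr lborel borel (\<lambda>(x, y). (a * x - b * y, b * x + a * y)) = lborel"
proof (cases "b = 0")
  case False
  thus ?thesis using assms by (rule lborel_distr_rotation_nonzero[rotated])
next
  case True
  hence "a = 1 \<or> a = - 1" using assms by (simp add: power2_eq_1_iff)
  thus ?thesis
  proof
    assume "a = 1"
    thus ?thesis
      using True distr_id2[of "borel :: (real \<times> real) measure" lborel] by (simp add: id_def case_prod_eta)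
  next
    let ?Q = "\<lambda>(x, y). (- y, x) :: real \<times> real"
    assume "a = - 1"
    hence eq: "(\<lambda>(x, y). (a * x - b * y, b * x + a * y)) = ?Q \<circ> ?Q"
      using True by (auto simp: fun_eq_iff)
    have m: "?Q \<in> borel_measurable borel"
      by (intro borel_measurable_continuous_onI; auto simp: split_beta intro!: continuous_intros)
    have Q: "distr lborel borel ?Q = lborel"
      using lborel_distr_rotation_nonzero[of 0 1] by simp
    have "distr lborel borel (?Q \<circ> ?Q) = distr (distr lborel borel ?Q) borel ?Q"
      using m by (simp add: distr_distr)
    thus ?thesis by (simp add: eq Q)
  qed
qed

section \<open>Moments of the disc along the first axis\<close>

lemma integral_semicircle_power_rec:
  fixes R :: real
  assumes "R > 0"
  shows "(real n + 4) * integral {-R..R} (\<lambda>x. x ^ (n + 2) * sqrt (R\<^sup>2 - x\<^sup>2)) =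
         (real n + 1) * R\<^sup>2 * integral {-R..R} (\<lambda>x. x ^ n * sqrt (R\<^sup>2 - x\<^sup>2))"
proof -
  define f where "f = (\<lambda>n x. x ^ n * sqrt (R\<^sup>2 - x\<^sup>2))"
  \<comment> \<open>This is x^(n+1) (R^2 - x^2)^(3/2). It vanishes at both ends of the interval, so
    the integral of its derivative is 0, which is the recursion.\<close>
  define F where "F = (\<lambda>x. x ^ (n + 1) * (R\<^sup>2 - x\<^sup>2) * sqrt (R\<^sup>2 - x\<^sup>2))"
  have int: "f m integrable_on {-R..R}" for m
    unfolding f_def by (intro integrable_continuous_interval continuous_intros)
  have "((\<lambda>x. (real n + 1) * R\<^sup>2 * f n x - (real n + 4) * f (n + 2) x)
      has_integral (F R - F (- R))) {-R..R}"
  \<comment> \<open>The square root has no derivative at the end points; continuity of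
    \<open>F\<close> on the closed interval and its derivative inside suffice.\<close>
  proof (rule fundamental_theorem_of_calculus_interior)
    fix x assume "x \<in> {-R<..<R}"
    hence "\<bar>x\<bar> < \<bar>R\<bar>" by auto
    hence pos: "R\<^sup>2 - x\<^sup>2 > 0" using abs_le_square_iff[of R x] by simp
    define s where "s = sqrt (R\<^sup>2 - x\<^sup>2)"
    have s: "s > 0" "R\<^sup>2 - x\<^sup>2 = s * s" using pos by (simp_all add: s_def)
    have ds: "((\<lambda>x. sqrt (R\<^sup>2 - x\<^sup>2)) has_real_derivative (- x / s)) (at x)"
      using pos unfolding s_def
      by (auto intro!: derivative_eq_intros simp: field_simps)
    have dp: "((\<lambda>x. x ^ (n + 1) * (R\<^sup>2 - x\<^sup>2)) has_real_derivative
        (real n + 1) * x ^ n * (R\<^sup>2 - x\<^sup>2) - x ^ (n + 1) * (2 * x)) (at x)"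
    proof -
      have "((\<lambda>x. x ^ (n + 1)) has_real_derivative (real n + 1) * x ^ n) (at x)"
        using DERIV_pow[of "Suc n" x UNIV] by (simp add: add.commute)
      moreover have "((\<lambda>x. R\<^sup>2 - x\<^sup>2) has_real_derivative - (2 * x)) (at x)"
        by (auto intro!: derivative_eq_intros)
      ultimately show ?thesis
        by (rule DERIV_cong[OF DERIV_mult]) (simp add: algebra_simps)
    qed
    have "(F has_real_derivative
        ((real n + 1) * x ^ n * (R\<^sup>2 - x\<^sup>2) - x ^ (n + 1) * (2 * x)) * s
          + x ^ (n + 1) * (R\<^sup>2 - x\<^sup>2) * (- x / s)) (at x)"
      using DERIV_mult[OF dp ds] by (simp add: F_def s_def mult.commute)
    \<comment> \<open>Replacing R^2 - x^2 by s * s makes the last term - x^(n+2) s, which joins - 2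
      x^(n+2) s to give the factor 3. Expanding the first term then contributes another n + 1, hence
      the n + 4 of the recursion.\<close>
    also have "((real n + 1) * x ^ n * (R\<^sup>2 - x\<^sup>2) - x ^ (n + 1) * (2 * x)) * s
          + x ^ (n + 1) * (R\<^sup>2 - x\<^sup>2) * (- x / s)
        = (real n + 1) * x ^ n * (R\<^sup>2 - x\<^sup>2) * s - 3 * x ^ (n + 2) * s"
      unfolding s(2) using s(1) by (simp add: field_simps)
    also have "\<dots> = (real n + 1) * R\<^sup>2 * f n x - (real n + 4) * f (n + 2) x"
      unfolding f_def s_def[symmetric] power_add by algebra
    finally show "(F has_vector_derivative
        (real n + 1) * R\<^sup>2 * f n x - (real n + 4) * f (n + 2) x) (at x)"
      by (simp add: has_real_derivative_iff_has_vector_derivative)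
  qed (use assms in \<open>auto simp: F_def intro!: continuous_intros\<close>)
  hence "((\<lambda>x. (real n + 1) * R\<^sup>2 * f n x - (real n + 4) * f (n + 2) x) has_integral 0) {-R..R}"
    by (simp add: F_def)
  moreover have "((\<lambda>x. (real n + 1) * R\<^sup>2 * f n x - (real n + 4) * f (n + 2) x) has_integral
      ((real n + 1) * R\<^sup>2 * integral {-R..R} (f n) - (real n + 4) * integral {-R..R} (f (n + 2)))) {-R..R}"
    by (intro has_integral_diff has_integral_mult_right integrable_integral int)
  ultimately have "0 = (real n + 1) * R\<^sup>2 * integral {-R..R} (f n)
      - (real n + 4) * integral {-R..R} (f (n + 2))"
    by (rule has_integral_unique)
  thus ?thesis by (simp add: f_def)
qed

lemma circular_surface_eq_cball: "R > 0 \<Longrightarrow> circular_surface R = cball 0 R"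
  by (auto simp: circular_surface_def norm_Pair real_le_lsqrt dest!: sqrt_le_D)

text \<open>The disc is compact. This supplies integrability of the moment integrands, of the terms
  of the exponential series and of the exponential itself.\<close>

lemma set_integrable_circular_surface:
  fixes f :: "real \<times> real \<Rightarrow> 'a :: {banach, second_countable_topology}"
  assumes "R > 0" and "continuous_on UNIV f"
  shows "set_integrable lborel (circular_surface R) f"
  using assms unfolding set_integrable_def
  by (auto simp: circular_surface_eq_cball intro!: borel_integrable_compact
      intro: continuous_on_subset)

text \<open>Fubini with the second coordinate integrated first: the slice of the disc over x in
  [-R, R] is an interval of length 2 sqrt (R^2 - x^2), and it is empty for other x.\<close>

lemma circular_surface_moment_integral:
  assumes "R > 0"
  shows "(LINT p:circular_surface R|lborel. fst p ^ n) =
         2 * integral {-R..R} (\<lambda>x. x ^ n * sqrt (R\<^sup>2 - x\<^sup>2))"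
proof -
  let ?D = "circular_surface R"
  let ?f = "\<lambda>p. indicator ?D p *\<^sub>R fst p ^ n :: real"
  have "integrable lborel ?f"
    using set_integrable_circular_surface[OF assms, of "\<lambda>p. fst p ^ n"]
    by (simp add: set_integrable_def continuous_intros)
  hence "integrable (lborel \<Otimes>\<^sub>M lborel) ?f" by (simp add: lborel_prod)
  from lborel_pair.integral_fst'[OF this]
  have "(LINT p:?D|lborel. fst p ^ n) = (LINT x|lborel. LINT y|lborel. ?f (x, y))"
    by (simp add: set_lebesgue_integral_def lborel_prod)
  also have "\<dots> = (LINT x:{-R..R}|lborel. 2 * (x ^ n * sqrt (R\<^sup>2 - x\<^sup>2)))"
    unfolding set_lebesgue_integral_def
  proof (rule Bochner_Integration.integral_cong[OF refl])
    fix x :: real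
    show "(LINT y|lborel. ?f (x, y)) = indicator {-R..R} x *\<^sub>R (2 * (x ^ n * sqrt (R\<^sup>2 - x\<^sup>2)))"
    proof (cases "x \<in> {-R..R}")
      case True
      hence "\<bar>x\<bar> \<le> \<bar>R\<bar>" by auto
      hence "x\<^sup>2 \<le> R\<^sup>2" by (simp add: abs_le_square_iff)
      hence "x\<^sup>2 + y\<^sup>2 \<le> R\<^sup>2 \<longleftrightarrow> y \<in> {- sqrt (R\<^sup>2 - x\<^sup>2)..sqrt (R\<^sup>2 - x\<^sup>2)}" for y
        using real_sqrt_le_iff[of "y\<^sup>2" "R\<^sup>2 - x\<^sup>2"] by auto
      hence "?f (x, y) = indicator {- sqrt (R\<^sup>2 - x\<^sup>2)..sqrt (R\<^sup>2 - x\<^sup>2)} y *\<^sub>R x ^ n" for y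
        by (auto simp: circular_surface_def indicator_def)
      hence "(LINT y|lborel. ?f (x, y)) =
          (LINT y|lborel. indicator {- sqrt (R\<^sup>2 - x\<^sup>2)..sqrt (R\<^sup>2 - x\<^sup>2)} y *\<^sub>R x ^ n)"
        by presburger
      thus ?thesis using True \<open>x\<^sup>2 \<le> R\<^sup>2\<close> by simp
    next
      case False
      hence "\<bar>x\<bar> > \<bar>R\<bar>" using assms by auto
      hence "x\<^sup>2 > R\<^sup>2" using abs_le_square_iff[of x R] by simp
      hence "x\<^sup>2 + y\<^sup>2 > R\<^sup>2" for y using zero_le_power2[of y] by linarith
      hence "?f (x, y) = 0" for y
        by (auto simp: circular_surface_def indicator_def not_le)
      hence "(LINT y|lborel. ?f (x, y)) = (LINT (y::real)|lborel. 0)" by presburger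
      thus ?thesis using False by simp
    qed
  qed
  also have "\<dots> = integral {-R..R} (\<lambda>x. 2 * (x ^ n * sqrt (R\<^sup>2 - x\<^sup>2)))"
    by (intro set_borel_integral_eq_integral(2) borel_integrable_atLeastAtMost')
       (intro continuous_intros)
  finally show ?thesis by simp
qed

lemma circular_surface_moment_rec:
  assumes "R > 0"
  shows "(real n + 4) * (LINT p:circular_surface R|lborel. fst p ^ (n + 2)) =
         (real n + 1) * R\<^sup>2 * (LINT p:circular_surface R|lborel. fst p ^ n)"
  using integral_semicircle_power_rec[OF assms, of n]
  unfolding circular_surface_moment_integral[OF assms] by simp

text \<open>The induction starts from the area of the disc. Passing from m to m + 1 multiplies the
  closed form by (R/2)^2 (2m+1)(2m+2) / ((m+1)(m+2)) = (2m+1) R^2 / (2m+4), the factor in the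
  recursion. The \<open>fact (2 * m)\<close> is kept in view to cancel against the exponential
  series.\<close>

lemma circular_surface_even_moment:
  assumes "R > 0"
  shows "(LINT p:circular_surface R|lborel. fst p ^ (2 * m)) =
         pi * R\<^sup>2 * (R / 2) ^ (2 * m) * fact (2 * m) / (fact m * fact (m + 1))"
proof (induction m)
  case 0
  have "measure lborel (circular_surface R) = pi * R\<^sup>2"
    using assms by (simp add: circular_surface_eq_cball content_cball unit_ball_vol_2 power2_eq_square)
  thus ?case by (simp add: set_lebesgue_integral_def)
next
  case (Suc m)
  let ?M = "\<lambda>n. LINT p:circular_surface R|lborel. fst p ^ n"
  have "?M (2 * Suc m) = (2 * real m + 1) * R\<^sup>2 * ?M (2 * m) / (2 * real m + 4)"
    using circular_surface_moment_rec[OF assms, of "2 * m"] by (simp add: field_simps)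
  also have "\<dots> = pi * R\<^sup>2 * (R / 2) ^ (2 * Suc m) * fact (2 * Suc m) / (fact (Suc m) * fact (Suc m + 1))"
    unfolding Suc.IH by (simp add: divide_simps) (simp add: algebra_simps power2_eq_square)
  finally show ?case .
qed

lemma circular_surface_odd_moment:
  assumes "R > 0" and "odd n"
  shows "(LINT p:circular_surface R|lborel. fst p ^ n) = 0"
proof -
  let ?I = "integral {-R..R} (\<lambda>x. x ^ n * sqrt (R\<^sup>2 - x\<^sup>2))"
  \<comment> \<open>Reflecting x to - x keeps the interval and negates the odd integrand, so
    \<open>?I\<close> equals its own negative.\<close>
  have "?I = integral {-R..R} (\<lambda>x. (- x) ^ n * sqrt (R\<^sup>2 - (- x)\<^sup>2))"
    using Henstock_Kurzweil_Integration.integral_reflect_real[of R "-R" "\<lambda>x. x ^ n * sqrt (R\<^sup>2 - x\<^sup>2)"] by simp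
  also have "\<dots> = - ?I" using assms by simp
  finally show ?thesis by (simp add: circular_surface_moment_integral[OF assms(1)])
qed

section \<open>Fourier transform of the disc\<close>

lemma circular_surface_fourier_axis_sums:
  assumes "R > 0"
  shows "(\<lambda>n. (\<i> * of_real c) ^ n / fact n *
            of_real (LINT p:circular_surface R|lborel. fst p ^ n)) sums
         (LINT p:circular_surface R|lborel. exp (\<i> * of_real (c * fst p)))"
proof -
  let ?D = "circular_surface R"
  define f where "f = (\<lambda>n p. indicator ?D p *\<^sub>R ((\<i> * of_real (c * fst p)) ^ n / fact n) :: complex)"
  have norm_f: "norm (f n p) = indicator ?D p * (\<bar>c * fst p\<bar> ^ n / fact n)" for n p
    by (simp add: f_def abs_mult norm_mult norm_divide norm_power)
  have f_sums: "(\<lambda>n. f n p) sums (indicator ?D p *\<^sub>R exp (\<i> * of_real (c * fst p)))" for p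
    unfolding f_def
    by (intro sums_scaleR_right) (use exp_converges[of "\<i> * of_real (c * fst p)"] in
        \<open>simp add: scaleR_conv_of_real field_simps\<close>)
  have int: "integrable lborel (f n)" for n
    using set_integrable_circular_surface[OF assms, of "\<lambda>p. (\<i> * of_real (c * fst p)) ^ n / fact n :: complex"]
    by (simp add: set_integrable_def f_def continuous_intros)
  \<comment> \<open>On the disc the first coordinate is at most R in absolute value. The resulting
    bounds sum to the area times exp (\<bar>c\<bar> R), which justifies integrating the series term
    by term.\<close>
  have bound: "norm (LINT p|lborel. norm (f n p)) \<le> measure lborel ?D * ((\<bar>c\<bar> * R) ^ n / fact n)" for n
  proof -
    have fin: "emeasure lborel ?D < \<infinity>"
      using assms by (intro emeasure_bounded_finite) (simp add: circular_surface_eq_cball)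
    have D: "?D \<in> sets lborel" using assms by (simp add: circular_surface_eq_cball)
    have "norm (f n p) \<le> indicator ?D p * ((\<bar>c\<bar> * R) ^ n / fact n)" for p
    proof (cases "p \<in> ?D")
      case True
      hence "\<bar>fst p\<bar> \<le> R"
        using assms norm_fst_le[of "fst p" "snd p"] by (simp add: circular_surface_eq_cball)
      thus ?thesis using True
        by (auto simp: norm_f abs_mult intro!: divide_right_mono power_mono mult_left_mono)
    qed (simp add: norm_f)
    hence "(LINT p|lborel. norm (f n p)) \<le> (LINT p|lborel. indicator ?D p * ((\<bar>c\<bar> * R) ^ n / fact n))"
      using int fin D by (intro integral_mono) auto
    thus ?thesis by simp
  qed
  have "(\<lambda>n. integral\<^sup>L lborel (f n)) sums (LINT p|lborel. (\<Sum>n. f n p))"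
  proof (rule sums_integral)
    show "AE p in lborel. summable (\<lambda>n. norm (f n p))"
    proof (rule AE_I2)
      fix p
      show "summable (\<lambda>n. norm (f n p))"
        unfolding norm_f using summable_exp[of "\<bar>c * fst p\<bar>"]
        by (intro summable_mult) (simp add: field_simps)
    qed
    show "summable (\<lambda>n. LINT p|lborel. norm (f n p))"
    proof (rule summable_comparison_test'[OF _ bound])
      show "summable (\<lambda>n. measure lborel ?D * ((\<bar>c\<bar> * R) ^ n / fact n))"
        using summable_exp[of "\<bar>c\<bar> * R"] by (intro summable_mult) (simp add: field_simps)
    qed
  qed (rule int)
  moreover have "(\<Sum>n. f n p) = indicator ?D p *\<^sub>R exp (\<i> * of_real (c * fst p))" for p
    using f_sums by (rule sums_unique[symmetric])
  moreover have "integral\<^sup>L lborel (f n) =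
      (\<i> * of_real c) ^ n / fact n * of_real (LINT p:?D|lborel. fst p ^ n)" for n
  proof -
    have "f n = (\<lambda>p. (\<i> * of_real c) ^ n / fact n * of_real (indicator ?D p *\<^sub>R fst p ^ n))"
      by (auto simp: f_def fun_eq_iff scaleR_conv_of_real power_mult_distrib)
    thus ?thesis
      by (simp only: integral_mult_right_zero integral_complex_of_real set_lebesgue_integral_def)
  qed
  ultimately show ?thesis by (simp add: set_lebesgue_integral_def)
qed

text \<open>Only even moments survive, and there (i c)^(2m) = (-1)^m c^(2m) while (2m)! cancels. For
  nonzero c the value is 2 pi R J_1(R c) / c; the power series form also covers c = 0.\<close>

lemma circular_surface_fourier_axis:
  assumes "R > 0"
  shows "(LINT p:circular_surface R|lborel. exp (\<i> * of_real (c * fst p))) =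
         of_real (pi * R\<^sup>2 * (\<Sum>m. (-1) ^ m / (fact m * fact (m + 1)) * ((R * c / 2)\<^sup>2) ^ m))"
proof -
  let ?M = "\<lambda>n. LINT p:circular_surface R|lborel. fst p ^ n"
  let ?F = "LINT p:circular_surface R|lborel. exp (\<i> * of_real (c * fst p))"
  let ?a = "\<lambda>m. (-1) ^ m / (fact m * fact (m + 1)) * ((R * c / 2)\<^sup>2) ^ m :: real"
  have "(\<lambda>m. (\<i> * of_real c) ^ (2 * m) / fact (2 * m) * of_real (?M (2 * m))) sums ?F"
  \<comment> \<open>The series over even indices has the same sum as the full one because every
    omitted term is 0.\<close>
  proof (subst sums_mono_reindex)
    show "strict_mono (\<lambda>m::nat. 2 * m)" by (simp add: strict_mono_def)
    fix n :: nat assume "n \<notin> range (\<lambda>m. 2 * m)"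
    hence "odd n" by (auto elim!: evenE)
    thus "(\<i> * of_real c) ^ n / fact n * of_real (?M n) = 0"
      by (simp add: circular_surface_odd_moment[OF assms])
  qed (rule circular_surface_fourier_axis_sums[OF assms])
  moreover have "(\<i> * of_real c) ^ (2 * m) / fact (2 * m) * of_real (?M (2 * m)) =
      of_real (pi * R\<^sup>2 * ?a m)" for m
  proof -
    have pow: "(R / 2) ^ (2 * m) * (c\<^sup>2) ^ m = ((R * c / 2)\<^sup>2) ^ m"
      by (simp only: power_mult flip: power_mult_distrib) simp
    have ipow: "(\<i> * complex_of_real c) ^ (2 * m) = of_real ((-1) ^ m * (c\<^sup>2) ^ m)"
      by (simp add: power_mult power_mult_distrib power_minus [of "(complex_of_real c)\<^sup>2"])
    have real_coeff: "(-1) ^ m * (c\<^sup>2) ^ m / fact (2 * m) * ?M (2 * m) = pi * R\<^sup>2 * ?a m"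
      unfolding circular_surface_even_moment[OF assms] pow[symmetric]
      by simp
    show ?thesis
      unfolding ipow real_coeff[symmetric] by (simp only: of_real_mult of_real_divide of_real_fact)
  qed
  ultimately have "(\<lambda>m. complex_of_real (pi * R\<^sup>2 * ?a m)) sums ?F" by simp
  moreover have "(\<lambda>m. complex_of_real (pi * R\<^sup>2 * ?a m)) sums of_real (pi * R\<^sup>2 * (\<Sum>m. ?a m))"
    using bessel_J_powser(1)[of 1] by (intro sums_of_real sums_mult summable_sums)
  ultimately show ?thesis by (rule sums_unique2)
qed

text \<open>A rotation taking the direction of (a, b) to the first axis preserves both the disc and
  the measure. The zero frequency has no direction, but there the two sides agree trivially.\<close>

lemma circular_surface_fourier_radial:
  assumes "R > 0"
  shows "(LINT p:circular_surface R|lborel. exp (\<i> * of_real (a * fst p + b * snd p))) =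
         (LINT p:circular_surface R|lborel. exp (\<i> * of_real (sqrt (a\<^sup>2 + b\<^sup>2) * fst p)))"
proof (cases "a = 0 \<and> b = 0")
  case False
  define \<rho> where "\<rho> = sqrt (a\<^sup>2 + b\<^sup>2)"
  have \<rho>: "\<rho> > 0" "\<rho>\<^sup>2 = a\<^sup>2 + b\<^sup>2"
    using False by (auto simp: \<rho>_def sum_power2_gt_zero_iff)
  \<comment> \<open>The sign of \<open>B\<close> makes the first coordinate of
    \<open>T (x, y)\<close> equal to (a x + b y) / \<rho>, so that the exponent of \<open>f\<close>
    at \<open>T (x, y)\<close> is the given linear form.\<close>
  define A B where "A = a / \<rho>" and "B = - b / \<rho>"
  have AB: "A\<^sup>2 + B\<^sup>2 = 1"
    using \<rho> False by (simp add: A_def B_def power_divide flip: add_divide_distrib)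
  define T where "T = (\<lambda>(x, y). (A * x - B * y, B * x + A * y))"
  define f where "f = (\<lambda>p. indicator (circular_surface R) p *\<^sub>R exp (\<i> * complex_of_real (\<rho> * fst p)))"
  have T: "T \<in> borel_measurable borel" unfolding T_def
    by (intro borel_measurable_continuous_onI; auto simp: split_beta intro!: continuous_intros)
  have "integrable lborel f"
    using set_integrable_circular_surface[OF assms, of "\<lambda>p. exp (\<i> * complex_of_real (\<rho> * fst p))"]
    by (simp add: set_integrable_def f_def continuous_intros)
  hence f: "f \<in> borel_measurable borel" by (simp add: borel_measurable_integrable)
  have "integral\<^sup>L lborel f = integral\<^sup>L (distr lborel borel T) f"
    unfolding T_def using lborel_distr_rotation[OF AB] by simp
  also have "\<dots> = (LINT p|lborel. f (T p))"
    using T f by (intro integral_distr) auto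
  also have "\<dots> = (LINT p:circular_surface R|lborel. exp (\<i> * of_real (a * fst p + b * snd p)))"
    unfolding set_lebesgue_integral_def
  proof (rule Bochner_Integration.integral_cong[OF refl], clarify)
    fix x y :: real
    have "(A * x - B * y)\<^sup>2 + (B * x + A * y)\<^sup>2 = (A\<^sup>2 + B\<^sup>2) * (x\<^sup>2 + y\<^sup>2)"
      by (simp add: power2_eq_square algebra_simps)
    hence "T (x, y) \<in> circular_surface R \<longleftrightarrow> (x, y) \<in> circular_surface R"
      by (simp add: T_def circular_surface_def AB)
    moreover have "\<rho> * fst (T (x, y)) = a * fst (x, y) + b * snd (x, y)"
      using \<rho>(1) by (simp add: T_def A_def B_def field_simps)
    ultimately show "f (T (x, y)) = indicator (circular_surface R) (x, y) *\<^sub>R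
        exp (\<i> * of_real (a * fst (x, y) + b * snd (x, y)))"
      unfolding f_def by (simp only: indicator_def)
  qed
  finally show ?thesis by (simp add: f_def \<rho>_def set_lebesgue_integral_def)
qed simp

section \<open>The gain as a power series, and the effective channel\<close>

lemma surface_gain_powser:
  assumes "\<kappa> > 0"
  shows "surface_gain R \<kappa> c =
         pi * R\<^sup>2 * (\<Sum>m. (-1) ^ m / (fact m * fact (m + 1)) * ((R * (\<kappa> * c) / 2)\<^sup>2) ^ m)"
proof (cases "c = 0")
  case True
  \<comment> \<open>The one-sided limit that defines the gain at 0 is the constant term of the
    series.\<close>
  have "surface_gain R \<kappa> 0 = pi * R\<^sup>2"
    unfolding surface_gain_def Let_def
    using tendsto_Lim[OF _ surface_gain_limit[of \<kappa> R]] assms by simp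
  thus ?thesis using True powser_zero[of "\<lambda>m. (-1) ^ m / (fact m * fact (m + 1)) :: real"] by simp
next
  case False
  thus ?thesis
    \<comment> \<open>The leading factor R \<kappa> c / 2 of J_1 cancels the denominator \<kappa> c
      and turns 2 pi R into pi R^2.\<close>
    unfolding surface_gain_def Let_def bessel_J_powser(2)[of 1 "R * \<kappa> * c"]
    using assms by (simp add: field_simps power2_eq_square)
qed

theorem proposition1:
  fixes R \<kappa> :: real and K k k' :: nat
    and pos :: "nat \<Rightarrow> real \<times> real \<times> real" and \<phi> :: "nat \<Rightarrow> real"
  assumes "R > 0" and "\<kappa> > 0"
    and "\<And>i. i \<in> {1..K} \<Longrightarrow> snd (snd (pos i)) > 0"
    and "\<And>i. i \<in> {1..K} \<Longrightarrow> \<phi> i \<in> {-pi..pi}"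
    and "k \<in> {1..K}" and "k' \<in> {1..K}"
  shows "effective_channel (circular_surface R)
           (far_field_channel \<kappa> (pos k) (\<phi> k)) (far_field_channel \<kappa> (pos k') (\<phi> k'))
         = phase_factor \<kappa> (pos k) (\<phi> k) (pos k') (\<phi> k')
           * complex_of_real (surface_gain R \<kappa> (chi (pos k) (pos k')))"
proof -
  let ?u = "pos k" and ?v = "pos k'"
  let ?A = "phase_factor \<kappa> ?u (\<phi> k) ?v (\<phi> k')"
  \<comment> \<open>The phase of a channel contains y_k y - x_k x, so in the product of one
    conjugated channel with the other the part linear in (x, y) is \<kappa> (\<xi> y - \<eta> x);
    the constant part goes into \<open>?A\<close>.\<close>
  define a b where "a = - \<kappa> * eta ?u ?v" and "b = \<kappa> * xi ?u ?v"
  have integrand: "cnj (far_field_channel \<kappa> ?u (\<phi> k) p) * far_field_channel \<kappa> ?v (\<phi> k') p =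
      ?A * exp (\<i> * of_real (a * fst p + b * snd p))" for p
  proof -
    obtain x1 y1 z1 x2 y2 z2 where uv: "?u = (x1, y1, z1)" "?v = (x2, y2, z2)"
      by (metis prod_cases3)
    show ?thesis
      unfolding far_field_channel_def phase_factor_def a_def b_def eta_def xi_def
      by (simp add: uv split_beta exp_cnj exp_add [symmetric] algebra_simps diff_divide_distrib)
  qed
  \<comment> \<open>Positivity of \<kappa> lets it leave the root without an absolute value. The
    radial transform is then evaluated at c = \<kappa> \<chi>, where its series is that of the
    gain.\<close>
  have "sqrt (a\<^sup>2 + b\<^sup>2) = \<kappa> * chi ?u ?v"
    using assms(2) by (simp add: a_def b_def chi_def power_mult_distrib real_sqrt_mult
        flip: distrib_left)
  moreover have "effective_channel (circular_surface R)
      (far_field_channel \<kappa> ?u (\<phi> k)) (far_field_channel \<kappa> ?v (\<phi> k')) =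
      ?A * (LINT p:circular_surface R|lborel. exp (\<i> * of_real (a * fst p + b * snd p)))"
    unfolding effective_channel_def integrand by simp
  ultimately show ?thesis
    by (simp only: circular_surface_fourier_radial[OF assms(1)]
        circular_surface_fourier_axis[OF assms(1)] surface_gain_powser[OF assms(2)])
qed

end
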